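(* If $T=M\times_\Phi^qS$ is a twisted product, where $M$ is a group and $\Phi=\Phi_{r,m}$ is a rigid twisting, then $\langle E(T)\rangle\cong\langle E(S)\rangle$.
   Context: $S$ is a monoid (multiplicative, identity $1$); $M$ is a commutative monoid (additive, identity $0$), here assumed to be an (abelian) group; $q\in M$ is fixed; $\mathbb N=\{0,1,2,\dots\}$. A twisting of $S$ is a map $\Phi:S\times S\to\mathbb N$ with $\Phi(a,b)+\Phi(ab,c)=\Phi(a,bc)+\Phi(b,c)$ for all $a,b,c\in S$. A twisting is rigid if it has the form $\Phi_{r,m}(a,b)=m-r(a)-r(b)+r(ab)$ for some function $r:S\to\mathbb Z$ and some $m\in\mathbb Z$ (so in particular $r(a)+r(b)\leq r(ab)+m$ for all $a,b\in S$). The twisted product $M\times_\Phi^qS$ is the semigroup with underlying set $M\times S$ and product $(i,a)(j,b)=(i+j+\Phi(a,b)q,\,ab)$, where $kq$ is the $k$-fold sum of $q$. $E(X)$ is the set of idempotents of a semigroup $X$, and $\langle E(X)\rangle$ is the subsemigroup generated by $E(X)$. No tightness assumption on $\Phi$ is made. *)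

theory Defs
  imports "HOL-Algebra.Group"
begin

definition twisting :: "('s, 'c) monoid_scheme \<Rightarrow> ('s \<Rightarrow> 's \<Rightarrow> nat) \<Rightarrow> bool" where
  "twisting S \<Phi> \<longleftrightarrow>
    (\<forall>a \<in> carrier S. \<forall>b \<in> carrier S. \<forall>c \<in> carrier S.
       \<Phi> a b + \<Phi> (a \<otimes>\<^bsub>S\<^esub> b) c = \<Phi> a (b \<otimes>\<^bsub>S\<^esub> c) + \<Phi> b c)"

text \<open>
  The right-hand side is computed in the integers; since a twisting takes values in the
  natural numbers, the equation forces r a + r b \<le> r (ab) + m on the carrier.
\<close>

definition rigid_form ::
    "('s, 'c) monoid_scheme \<Rightarrow> ('s \<Rightarrow> int) \<Rightarrow> int \<Rightarrow> ('s \<Rightarrow> 's \<Rightarrow> nat) \<Rightarrow> bool" where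
  "rigid_form S r m \<Phi> \<longleftrightarrow>
    (\<forall>a \<in> carrier S. \<forall>b \<in> carrier S. int (\<Phi> a b) = m - r a - r b + r (a \<otimes>\<^bsub>S\<^esub> b))"

definition rigid_twisting :: "('s, 'c) monoid_scheme \<Rightarrow> ('s \<Rightarrow> 's \<Rightarrow> nat) \<Rightarrow> bool" where
  "rigid_twisting S \<Phi> \<longleftrightarrow> twisting S \<Phi> \<and> (\<exists>r m. rigid_form S r m \<Phi>)"

text \<open>
  The commutative monoid M, written additively on paper, is a multiplicative structure here,
  so the k-fold sum kq becomes the power of q with exponent k.
  The twisted product is in general only a semigroup. It is represented by a monoid record
  because carrier, multiplication, homomorphisms and isomorphisms of HOL-Algebra live there;
  its unit field carries no information and is left unspecified. The HOL-Algebra notion of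
  isomorphism refers to carriers and multiplications only, so it is semigroup isomorphism.
\<close>

definition twisted_product ::
    "('m, 'b) monoid_scheme \<Rightarrow> 'm \<Rightarrow> ('s, 'c) monoid_scheme \<Rightarrow> ('s \<Rightarrow> 's \<Rightarrow> nat)
      \<Rightarrow> ('m \<times> 's) monoid" where
  "twisted_product M q S \<Phi> =
    \<lparr>carrier = carrier M \<times> carrier S,
     mult = (\<lambda>(i, a) (j, b). (i \<otimes>\<^bsub>M\<^esub> j \<otimes>\<^bsub>M\<^esub> (q [^]\<^bsub>M\<^esub> \<Phi> a b), a \<otimes>\<^bsub>S\<^esub> b)),
     one = undefined\<rparr>"

definition idempotents :: "('a, 'b) monoid_scheme \<Rightarrow> 'a set" where
  "idempotents X = {e \<in> carrier X. e \<otimes>\<^bsub>X\<^esub> e = e}"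

inductive_set subsemigroup_generated :: "('a, 'b) monoid_scheme \<Rightarrow> 'a set \<Rightarrow> 'a set"
  for X and A where
    incl: "a \<in> A \<Longrightarrow> a \<in> subsemigroup_generated X A"
  | mult: "a \<in> subsemigroup_generated X A \<Longrightarrow> b \<in> subsemigroup_generated X A
            \<Longrightarrow> a \<otimes>\<^bsub>X\<^esub> b \<in> subsemigroup_generated X A"

definition idempotent_generated :: "('a, 'b) monoid_scheme \<Rightarrow> ('a, 'b) monoid_scheme" where
  "idempotent_generated X = X\<lparr>carrier := subsemigroup_generated X (idempotents X)\<rparr>"

end

(* For a rigid twisting, g a = (r a - m) q satisfies g a + g b + \<Phi>(a, b) q = g (a b), so
   a \<mapsto> (g a, a) is a section of the projection of T onto S that is a homomorphism. Since M is
   cancellative, (i, a) is idempotent in T iff a is idempotent in S and i = g a. Hence the section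
   maps the idempotent-generated subsemigroup of S onto that of T. *)
theory Submission
  imports Defs
begin

lemma subsemigroup_generated_subset_carrier:
  assumes "monoid S" and "A \<subseteq> carrier S"
  shows "subsemigroup_generated S A \<subseteq> carrier S"
proof
  fix x assume "x \<in> subsemigroup_generated S A"
  then show "x \<in> carrier S"
    by (induction rule: subsemigroup_generated.induct)
      (use assms in \<open>auto intro: monoid.m_closed\<close>)
qed

text \<open>Each inclusion is an induction over generation, with \<open>h\<close> carrying products
  across. As \<open>h\<close> is multiplicative on the carrier only, \<open>A\<close> is taken
  inside it, and then so is everything that \<open>A\<close> generates.\<close>

lemma subsemigroup_generated_hom_image:
  assumes S: "monoid S" and A: "A \<subseteq> carrier S" and h: "h \<in> hom S T"
  shows "subsemigroup_generated T (h ` A) = h ` subsemigroup_generated S A"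
proof (intro equalityI subsetI)
  note carr = subsemigroup_generated_subset_carrier[OF S A, THEN subsetD]
  fix y assume "y \<in> subsemigroup_generated T (h ` A)"
  then show "y \<in> h ` subsemigroup_generated S A"
  proof (induction rule: subsemigroup_generated.induct)
    case (incl a)
    then show ?case by (auto intro: subsemigroup_generated.incl)
  next
    case (mult a b)
    then obtain x y where x: "x \<in> subsemigroup_generated S A" "a = h x"
      and y: "y \<in> subsemigroup_generated S A" "b = h y" by blast
    then have "a \<otimes>\<^bsub>T\<^esub> b = h (x \<otimes>\<^bsub>S\<^esub> y)"
      using hom_mult[OF h] carr by simp
    then show ?case
      using x y by (auto intro: subsemigroup_generated.mult)
  qed
next
  note carr = subsemigroup_generated_subset_carrier[OF S A, THEN subsetD]
  fix y assume "y \<in> h ` subsemigroup_generated S A"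
  then obtain x where "x \<in> subsemigroup_generated S A" and y: "y = h x" by blast
  then have "h x \<in> subsemigroup_generated T (h ` A)"
  proof (induction arbitrary: y rule: subsemigroup_generated.induct)
    case (incl a)
    then show ?case by (auto intro: subsemigroup_generated.incl)
  next
    case (mult a b)
    then show ?case
      using hom_mult[OF h] carr by (simp add: subsemigroup_generated.mult)
  qed
  then show "y \<in> subsemigroup_generated T (h ` A)" by (simp add: y)
qed

lemma carrier_twisted_product [simp]:
  "carrier (twisted_product M q S \<Phi>) = carrier M \<times> carrier S"
  by (simp add: twisted_product_def)

lemma mult_twisted_product [simp]:
  "(i, a) \<otimes>\<^bsub>twisted_product M q S \<Phi>\<^esub> (j, b)
    = (i \<otimes>\<^bsub>M\<^esub> j \<otimes>\<^bsub>M\<^esub> (q [^]\<^bsub>M\<^esub> \<Phi> a b), a \<otimes>\<^bsub>S\<^esub> b)"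
  by (simp add: twisted_product_def)

context
  fixes S :: "('s, 'c) monoid_scheme" and M :: "('m, 'b) monoid_scheme"
    and q :: 'm and \<Phi> :: "'s \<Rightarrow> 's \<Rightarrow> nat" and r :: "'s \<Rightarrow> int" and m :: int
  assumes M: "comm_group M" and q: "q \<in> carrier M" and r: "rigid_form S r m \<Phi>"
begin

interpretation M: comm_group M by (fact M)

text \<open>The exponents on the left add up to the one on the right, by the rigidity equation.
  Exponents such as \<open>r a - m\<close> may be negative, so these are integer powers, available
  because \<open>M\<close> is a group; \<open>int_pow_int\<close> brings the natural power at
  \<open>\<Phi> a b\<close> into the same form.\<close>

lemma rigid_section_cocycle:
  assumes "a \<in> carrier S" and "b \<in> carrier S"
  shows "q [^]\<^bsub>M\<^esub> (r a - m) \<otimes>\<^bsub>M\<^esub> q [^]\<^bsub>M\<^esub> (r b - m) \<otimes>\<^bsub>M\<^esub> q [^]\<^bsub>M\<^esub> \<Phi> a b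
    = q [^]\<^bsub>M\<^esub> (r (a \<otimes>\<^bsub>S\<^esub> b) - m)"
proof -
  have "int (\<Phi> a b) = m - r a - r b + r (a \<otimes>\<^bsub>S\<^esub> b)"
    using r assms by (simp add: rigid_form_def)
  then have "r a - m + (r b - m) + int (\<Phi> a b) = r (a \<otimes>\<^bsub>S\<^esub> b) - m" by simp
  then show ?thesis
    using q by (metis M.int_pow_mult int_pow_int)
qed

lemma rigid_section_hom:
  "(\<lambda>a. (q [^]\<^bsub>M\<^esub> (r a - m), a)) \<in> hom S (twisted_product M q S \<Phi>)"
  by (rule homI) (use q in \<open>simp_all add: rigid_section_cocycle\<close>)

text \<open>Over an idempotent \<open>a\<close>, idempotency of \<open>(i, a)\<close> says that
  \<open>i\<close> is inverse to the power of \<open>q\<close> at \<open>\<Phi> a a\<close>. The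
  cocycle identity at \<open>(a, a)\<close> says the same of the section value, and inverses are
  unique.\<close>

lemma rigid_idempotents_twisted_product:
  "idempotents (twisted_product M q S \<Phi>)
    = (\<lambda>a. (q [^]\<^bsub>M\<^esub> (r a - m), a)) ` idempotents S"
proof -
  have "i \<otimes>\<^bsub>M\<^esub> i \<otimes>\<^bsub>M\<^esub> q [^]\<^bsub>M\<^esub> \<Phi> a a = i \<longleftrightarrow> i = q [^]\<^bsub>M\<^esub> (r a - m)"
    if i: "i \<in> carrier M" and a: "a \<in> carrier S" "a \<otimes>\<^bsub>S\<^esub> a = a" for i a
  proof -
    let ?g = "q [^]\<^bsub>M\<^esub> (r a - m)" and ?p = "q [^]\<^bsub>M\<^esub> \<Phi> a a"
    have g: "?g \<in> carrier M" and p: "?p \<in> carrier M" using q by simp_all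
    \<comment> \<open>Bracketed to the right, so that the leading \<open>?g\<close> cancels.\<close>
    have gg: "?g \<otimes>\<^bsub>M\<^esub> (?g \<otimes>\<^bsub>M\<^esub> ?p) = ?g"
      using rigid_section_cocycle[of a a] a g p by (simp add: M.m_assoc)
    then have gp: "?g \<otimes>\<^bsub>M\<^esub> ?p = \<one>\<^bsub>M\<^esub>"
      using g p by simp
    have "i \<otimes>\<^bsub>M\<^esub> i \<otimes>\<^bsub>M\<^esub> ?p = i \<longleftrightarrow> i \<otimes>\<^bsub>M\<^esub> ?p = \<one>\<^bsub>M\<^esub>"
      using i p by (simp add: M.m_assoc)
    also have "\<dots> \<longleftrightarrow> i = ?g"
      using i g p gp M.right_cancel by metis
    finally show ?thesis .
  qed
  \<comment> \<open>An idempotent of the twisted product has an idempotent second coordinate, so the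
    equivalence over a fixed \<open>a\<close> settles both inclusions.\<close>
  then show ?thesis
    using q by (force simp: idempotents_def)
qed

end

theorem theorem8p3:
  fixes S :: "('s, 'c) monoid_scheme" and M :: "('m, 'b) monoid_scheme"
    and q :: 'm and \<Phi> :: "'s \<Rightarrow> 's \<Rightarrow> nat"
  assumes "monoid S" and "comm_group M" and "q \<in> carrier M" and "rigid_twisting S \<Phi>"
  shows "idempotent_generated (twisted_product M q S \<Phi>) \<cong> idempotent_generated S"
proof -
  let ?T = "twisted_product M q S \<Phi>"
  let ?E = "subsemigroup_generated S (idempotents S)"
  obtain r m where r: "rigid_form S r m \<Phi>"
    using assms(4) by (auto simp: rigid_twisting_def)
  let ?h = "\<lambda>a. (q [^]\<^bsub>M\<^esub> (r a - m), a)"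
  have "subsemigroup_generated ?T (idempotents ?T) = ?h ` ?E"
    unfolding rigid_idempotents_twisted_product[OF assms(2,3) r]
    by (rule subsemigroup_generated_hom_image[OF assms(1) _ rigid_section_hom[OF assms(2,3) r]])
      (auto simp: idempotents_def)
  \<comment> \<open>The projection is multiplicative whatever the first coordinates are. It is
    injective here because the carrier is the graph of the first coordinate of \<open>?h\<close>
    over \<open>?E\<close>.\<close>
  then have "snd \<in> iso (idempotent_generated ?T) (idempotent_generated S)"
    by (auto simp: iso_def hom_def bij_betw_def inj_on_def image_image idempotent_generated_def
        intro: subsemigroup_generated.mult)
  then show ?thesis by (rule is_isoI)
qed

end
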